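(* If a separable Banach space $X$ has an FDD, then $X$ admits a small GCCR, i.e. there is a small convex compact set $K\subset X$ with $\overline{\mathrm{span}}(K)=X$ such that there exists a Lipschitz retraction from $X$ onto $K$.
   Context: All Banach spaces are real. A sequence $(X_n)_{n\in\mathbb{N}}$ of nonzero finite dimensional subspaces of $X$ is an FDD (finite dimensional decomposition) if for every $x\in X$ there is a unique sequence $x_n\in X_n$ with $\|x-\sum_{i=1}^n x_i\|\to0$. A retraction from $X$ onto $K\subset X$ is a map $R:X\to K$ with $R|_K=\mathrm{Id}_K$. A GCCR (generating convex compact retract) of $X$ is a convex compact subset $K\subset X$ whose closed linear span is $X$ and onto which there is a Lipschitz retraction from $X$. A fundamental sequence in $X$ is a sequence $\beta=(e_n)\subset X$ whose closed linear span is $X$; put $E_n^\beta=\mathrm{span}\{e_1,\dots,e_n\}$. For a bounded set $K\subset X$ define the inner radii $r_n^\beta=\sup\{r\ge0: B_{E_n^\beta}(x,r)\subset K\cap E_n^\beta \text{ for some } x\in E_n^\beta\}$, where $B_{E_n^\beta}(x,r)$ is the closed ball in $E_n^\beta$ with centre $x$ and radius $r$, and the heights $h_n^\beta=\sup\{d(x,E_n^\beta): x\in K\}$. A bounded set $K\subset X$ is small if there exist $\varepsilon\in(0,1)$, a fundamental sequence $\beta$ in $X$ and a strictly increasing $\sigma:\mathbb{N}\to\mathbb{N}$ such that for all $n\in\mathbb{N}$ $$0<\frac{h_{\sigma(n)}^\beta}{r_{\sigma(n)}^\beta}\le\frac{1}{2\sigma(n)^2\left(\left(1+\frac{2}{\varepsilon}\right)^{\sigma(n)}+2\right)}.$$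 *)

theory Defs
  imports "HOL-Analysis.Analysis"
begin

text \<open>
  Sequences are indexed from 0: the \<open>n\<close>-th term in the usual numbering
  \<open>1, 2, \<dots>\<close> is the value at \<open>n - 1\<close>.
\<close>

definition fdd :: "(nat \<Rightarrow> 'a::real_normed_vector set) \<Rightarrow> bool" where
  "fdd X \<longleftrightarrow>
     (\<forall>n. subspace (X n) \<and> X n \<noteq> {0} \<and> (\<exists>B. finite B \<and> span B = X n)) \<and>
     (\<forall>x. \<exists>!u. (\<forall>n. u n \<in> X n) \<and> (\<lambda>n. norm (x - (\<Sum>i<n. u i))) \<longlonglongrightarrow> 0)"

definition lipschitz_retraction_onto :: "'a::real_normed_vector set \<Rightarrow> ('a \<Rightarrow> 'a) \<Rightarrow> bool" where
  "lipschitz_retraction_onto K R \<longleftrightarrow>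
     R \<in> UNIV \<rightarrow> K \<and> (\<forall>x\<in>K. R x = x) \<and> (\<exists>L. L-lipschitz_on UNIV R)"

definition gccr :: "'a::real_normed_vector set \<Rightarrow> bool" where
  "gccr K \<longleftrightarrow>
     convex K \<and> compact K \<and> closure (span K) = UNIV \<and> (\<exists>R. lipschitz_retraction_onto K R)"

definition fundamental_sequence :: "(nat \<Rightarrow> 'a::real_normed_vector) \<Rightarrow> bool" where
  "fundamental_sequence \<beta> \<longleftrightarrow> closure (span (range \<beta>)) = UNIV"

definition initial_span :: "(nat \<Rightarrow> 'a::real_normed_vector) \<Rightarrow> nat \<Rightarrow> 'a set" where
  "initial_span \<beta> n = span (\<beta> ` {..<n})"

text \<open>
  The suprema are taken in \<open>[0, \<infinity>]\<close>, so that they have their usual meaning in the degenerate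
  cases: the inner radius is \<open>0\<close> if \<open>K\<close> misses the subspace, and \<open>\<infinity>\<close> if the subspace is
  \<open>{0}\<close> and contained in \<open>K\<close>. Real-valued \<open>Sup\<close> would be unspecified there.
\<close>

definition inner_radius :: "(nat \<Rightarrow> 'a::real_normed_vector) \<Rightarrow> 'a set \<Rightarrow> nat \<Rightarrow> ennreal" where
  "inner_radius \<beta> K n =
     (SUP r \<in> {r::real. 0 \<le> r \<and>
        (\<exists>x \<in> initial_span \<beta> n. cball x r \<inter> initial_span \<beta> n \<subseteq> K \<inter> initial_span \<beta> n)}.
      ennreal r)"

definition height :: "(nat \<Rightarrow> 'a::real_normed_vector) \<Rightarrow> 'a set \<Rightarrow> nat \<Rightarrow> ennreal" where
  "height \<beta> K n = (SUP x \<in> K. ennreal (infdist x (initial_span \<beta> n)))"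

text \<open>
  In \<^typ>\<open>ennreal\<close>, \<open>h / 0 = \<infinity>\<close> for \<open>h > 0\<close>, \<open>0 / 0 = 0\<close> and \<open>h / \<infinity> = 0\<close> for
  finite \<open>h\<close>, so the two inequalities force \<open>0 < r < \<infinity>\<close> and \<open>0 < h\<close>.
\<close>

definition small :: "'a::real_normed_vector set \<Rightarrow> bool" where
  "small K \<longleftrightarrow>
     bounded K \<and>
     (\<exists>(\<epsilon>::real) \<beta> (\<sigma>::nat \<Rightarrow> nat).
        0 < \<epsilon> \<and> \<epsilon> < 1 \<and> fundamental_sequence \<beta> \<and> strict_mono \<sigma> \<and> (\<forall>n. 1 \<le> \<sigma> n) \<and>
        (\<forall>n. 0 < height \<beta> K (\<sigma> n) / inner_radius \<beta> K (\<sigma> n) \<and>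
             height \<beta> K (\<sigma> n) / inner_radius \<beta> K (\<sigma> n)
               \<le> ennreal (1 / (2 * real (\<sigma> n) ^ 2 * ((1 + 2 / \<epsilon>) ^ \<sigma> n + 2)))))"

end

theory Submission
  imports Defs
begin

text \<open>
  Let \<open>x\<^sub>n\<close> denote the coordinates of \<open>x\<close> in the FDD and \<open>P\<^sub>n\<close> its partial sum projections, which are
  uniformly bounded by the Baire category theorem. For rapidly growing weights \<open>b\<^sub>n\<close> put
  \<open>K = {x. (\<Sum>n. b\<^sub>n \<bar>x\<^sub>n\<bar>) \<le> 1}\<close>. The retraction onto \<open>K\<close> copies the coordinates of \<open>x\<close>, in order,
  until the budget \<open>1\<close> is used up: it shrinks the coordinate that would exceed the budget and sets
  all later ones to \<open>0\<close>. Thus it equals some \<open>P\<^sub>n x\<close> up to one shrunk coordinate, so that no sum of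
  infinitely many truncation errors occurs, and it is Lipschitz although the decomposition need not
  be unconditional. Since \<open>K\<close> has height at most \<open>1 / b\<^sub>n\<close> over the first \<open>n\<close> summands and inner
  radius at least a constant multiple of \<open>1 / (\<Sum>i<n. b\<^sub>i)\<close> there, it is small if the weights grow
  fast enough compared with the dimensions.
\<close>

section \<open>Finite dimensional spans: closedness and local compactness\<close>

text \<open>The two claims feed each other: compactness for all radii gives closedness, and
  closedness of \<open>span B\<close> drives the induction step. A new vector \<open>b\<close>
  outside \<open>span B\<close> then has positive distance \<open>d\<close> from it, which bounds
  its coefficient by \<open>M / d\<close>, so the bounded part lies in a sum of two compact
  sets.\<close>

lemma finite_span_bounded_in_compact:
  fixes B :: "'a::real_normed_vector set"
  assumes "finite B"
  shows "\<exists>C. compact C \<and> C \<subseteq> span B \<and> span B \<inter> cball 0 M \<subseteq> C"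
    and "closed (span B)"
proof -
  have cl: "closed (span B)"
    if bdd: "\<And>M. \<exists>C. compact C \<and> C \<subseteq> span B \<and> span B \<inter> cball 0 M \<subseteq> C" for B :: "'a set"
  proof (unfold closed_sequential_limits, intro allI impI, elim conjE)
    fix f l assume f: "\<forall>n. f n \<in> span B" and lim: "f \<longlonglongrightarrow> l"
    obtain M where "\<And>n. norm (f n) \<le> M"
      using convergent_imp_Bseq[OF convergentI[OF lim]] by (auto simp: Bseq_def)
    moreover obtain C where C: "compact C" "C \<subseteq> span B" "span B \<inter> cball 0 M \<subseteq> C"
      using bdd by blast
    ultimately have "f n \<in> C" for n
      using f by auto
    then show "l \<in> span B"
      using C lim closed_sequentially[OF compact_imp_closed[OF C(1)]] by blast
  qed
  have main: "\<exists>C. compact C \<and> C \<subseteq> span B \<and> span B \<inter> cball 0 M \<subseteq> C" for M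
    using assms
  proof (induction B arbitrary: M rule: finite_induct)
    case empty
    show ?case by (rule exI[of _ "{0}"]) auto
  next
    case (insert b B)
    show ?case
    proof (cases "b \<in> span B")
      case True
      then show ?thesis using insert.IH by (simp add: span_redundant)
    next
      case False
      define d where "d = infdist b (span B)"
      have d: "d > 0"
        unfolding d_def
        by (rule infdist_pos_not_in_closed[OF cl[OF insert.IH] _ False]) (use span_zero in blast)
      obtain C where C: "compact C" "C \<subseteq> span B" "span B \<inter> cball 0 (M + M / d * norm b) \<subseteq> C"
        using insert.IH by blast
      let ?C = "{x + y | x y. x \<in> C \<and> y \<in> (\<lambda>t. t *\<^sub>R b) ` {- M / d .. M / d}}"
      have "compact ?C"
        by (intro compact_sums C compact_continuous_image continuous_intros) simp
      moreover have "?C \<subseteq> span (insert b B)"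
      proof -
        have "C \<subseteq> span (insert b B)"
          using C(2) span_mono[of B "insert b B"] by blast
        then show ?thesis
          by (auto intro!: span_add[of _ "insert b B"] span_scale intro: span_base)
      qed
      moreover have "span (insert b B) \<inter> cball 0 M \<subseteq> ?C"
      proof
        fix x assume x: "x \<in> span (insert b B) \<inter> cball 0 M"
        then obtain t where v: "x - t *\<^sub>R b \<in> span B"
          by (auto simp: span_breakdown_eq)
        have nx: "norm x \<le> M" using x by simp
        have t: "\<bar>t\<bar> * d \<le> M"
        proof (cases "t = 0")
          case True
          then show ?thesis using order_trans[OF norm_ge_zero nx] by simp
        next
          case False
          \<comment> \<open>This vector is \<open>b - (1 / t) *\<^sub>R x\<close>, at distance
            \<open>norm x / \<bar>t\<bar>\<close> from \<open>b\<close>.\<close>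
          have "(- 1 / t) *\<^sub>R (x - t *\<^sub>R b) \<in> span B"
            using v by (rule span_scale)
          then have "d \<le> dist b ((- 1 / t) *\<^sub>R (x - t *\<^sub>R b))"
            unfolding d_def by (rule infdist_le)
          also have "\<dots> = norm ((1 / t) *\<^sub>R x)"
            using False by (simp add: dist_norm scaleR_diff_right)
          also have "\<dots> = norm x / \<bar>t\<bar>"
            by (simp add: divide_inverse)
          finally show ?thesis
            using False nx by (simp add: field_simps)
        qed
        then have t': "\<bar>t\<bar> \<le> M / d"
          using d by (simp add: field_simps)
        have "norm (x - t *\<^sub>R b) \<le> norm x + \<bar>t\<bar> * norm b"
          by (metis norm_scaleR norm_triangle_ineq4)
        also have "\<dots> \<le> M + M / d * norm b"
          using nx t' by (intro add_mono mult_right_mono) auto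
        finally have "x - t *\<^sub>R b \<in> C"
          using C v by auto
        moreover have "t *\<^sub>R b \<in> (\<lambda>t. t *\<^sub>R b) ` {- M / d .. M / d}"
          using t' by (intro image_eqI[of _ _ t]) auto
        ultimately show "x \<in> ?C"
          by (smt (verit) diff_add_cancel mem_Collect_eq)
      qed
      ultimately show ?thesis by blast
    qed
  qed
  show "\<exists>C. compact C \<and> C \<subseteq> span B \<and> span B \<inter> cball 0 M \<subseteq> C"
    by (rule main)
  show "closed (span B)"
    by (rule cl[OF main])
qed

section \<open>Coordinates and partial sum projections of an FDD\<close>

definition fdd_coord :: "(nat \<Rightarrow> 'a::real_normed_vector set) \<Rightarrow> nat \<Rightarrow> 'a \<Rightarrow> 'a" where
  "fdd_coord X i x =
     (THE u. (\<forall>n. u n \<in> X n) \<and> (\<lambda>n. norm (x - (\<Sum>i<n. u i))) \<longlonglongrightarrow> 0) i"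

definition fdd_proj :: "(nat \<Rightarrow> 'a::real_normed_vector set) \<Rightarrow> nat \<Rightarrow> 'a \<Rightarrow> 'a" where
  "fdd_proj X n x = (\<Sum>i<n. fdd_coord X i x)"

lemma norm_diff_tendsto_0_iff:
  fixes f :: "nat \<Rightarrow> 'a::real_normed_vector"
  shows "(\<lambda>n. norm (x - f n)) \<longlonglongrightarrow> 0 \<longleftrightarrow> f \<longlonglongrightarrow> x"
  by (subst norm_minus_commute) (simp add: tendsto_norm_zero_iff LIM_zero_iff)

context
  fixes X :: "nat \<Rightarrow> 'a::real_normed_vector set"
  assumes X: "fdd X"
begin

lemma fdd_subspace: "subspace (X n)"
  and fdd_nontrivial: "X n \<noteq> {0}"
  and fdd_finite_dim: "\<exists>B. finite B \<and> span B = X n"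
  using X by (auto simp: fdd_def)

lemma fdd_closed: "closed (X n)"
  using fdd_finite_dim finite_span_bounded_in_compact(2) by metis

lemma fdd_coord_in: "fdd_coord X n x \<in> X n"
  and fdd_proj_tendsto: "(\<lambda>n. fdd_proj X n x) \<longlonglongrightarrow> x"
proof -
  have "\<exists>!u. (\<forall>n. u n \<in> X n) \<and> (\<lambda>n. norm (x - (\<Sum>i<n. u i))) \<longlonglongrightarrow> 0"
    using X by (simp add: fdd_def)
  from theI'[OF this] show "fdd_coord X n x \<in> X n" "(\<lambda>n. fdd_proj X n x) \<longlonglongrightarrow> x"
    by (simp_all add: fdd_coord_def fdd_proj_def norm_diff_tendsto_0_iff)
qed

lemma fdd_coord_unique:
  assumes "\<And>n. u n \<in> X n" "(\<lambda>n. \<Sum>i<n. u i) \<longlonglongrightarrow> x"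
  shows "fdd_coord X i x = u i"
proof -
  have "\<exists>!u. (\<forall>n. u n \<in> X n) \<and> (\<lambda>n. norm (x - (\<Sum>i<n. u i))) \<longlonglongrightarrow> 0"
    using X by (simp add: fdd_def)
  from the1_equality[OF this, of u] show ?thesis
    using assms by (simp add: fdd_coord_def norm_diff_tendsto_0_iff)
qed

lemma linear_fdd_coord: "linear (fdd_coord X i)"
proof (rule linearI)
  fix x y
  show "fdd_coord X i (x + y) = fdd_coord X i x + fdd_coord X i y"
  proof (rule fdd_coord_unique)
    show "fdd_coord X n x + fdd_coord X n y \<in> X n" for n
      by (intro subspace_add fdd_subspace fdd_coord_in)
    show "(\<lambda>n. \<Sum>i<n. fdd_coord X i x + fdd_coord X i y) \<longlonglongrightarrow> x + y"
      using tendsto_add[OF fdd_proj_tendsto fdd_proj_tendsto]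
      by (simp add: fdd_proj_def sum.distrib)
  qed
next
  fix r x
  show "fdd_coord X i (r *\<^sub>R x) = r *\<^sub>R fdd_coord X i x"
  proof (rule fdd_coord_unique)
    show "r *\<^sub>R fdd_coord X n x \<in> X n" for n
      by (intro subspace_scale fdd_subspace fdd_coord_in)
    show "(\<lambda>n. \<Sum>i<n. r *\<^sub>R fdd_coord X i x) \<longlonglongrightarrow> r *\<^sub>R x"
      using tendsto_scaleR[OF tendsto_const fdd_proj_tendsto]
      by (simp add: fdd_proj_def scaleR_sum_right)
  qed
qed

lemma linear_fdd_proj: "linear (fdd_proj X n)"
  unfolding fdd_proj_def by (intro linear_compose_sum ballI linear_fdd_coord)

text \<open>Padding with zeros turns the finite sum into an admissible expansion, whose partial sums
  are eventually constant; uniqueness reads off the coordinates.\<close>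

lemma fdd_coord_sum:
  assumes "\<And>i. i < n \<Longrightarrow> v i \<in> X i"
  shows "fdd_coord X i (\<Sum>i<n. v i) = (if i < n then v i else 0)"
proof (rule fdd_coord_unique)
  show "(if k < n then v k else 0) \<in> X k" for k
    using assms fdd_subspace subspace_0 by auto
  have "(\<Sum>i<k. if i < n then v i else 0) = (\<Sum>i<n. v i)" if "k \<ge> n" for k
  proof -
    have "(\<Sum>i<k. if i < n then v i else 0) = (\<Sum>i | i \<in> {..<k} \<and> i < n. v i)"
      by (simp add: sum.If_cases Int_def)
    also have "{i. i \<in> {..<k} \<and> i < n} = {..<n}"
      using that by auto
    finally show ?thesis .
  qed
  then show "(\<lambda>k. \<Sum>i<k. if i < n then v i else 0) \<longlonglongrightarrow> (\<Sum>i<n. v i)"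
    by (intro tendsto_eventually) (auto simp: eventually_sequentially)
qed

lemma fdd_coord_eq:
  assumes "v \<in> X j"
  shows "fdd_coord X i v = (if i = j then v else 0)"
proof -
  have "v = (\<Sum>i<Suc j. if i = j then v else 0)"
    by simp
  moreover have "fdd_coord X i (\<Sum>i<Suc j. if i = j then v else 0) = (if i = j then v else 0)"
    by (subst fdd_coord_sum) (use assms fdd_subspace subspace_0 in auto)
  ultimately show ?thesis by simp
qed

lemma fdd_coord_proj:
  "fdd_coord X i (fdd_proj X n x) = (if i < n then fdd_coord X i x else 0)"
  unfolding fdd_proj_def by (rule fdd_coord_sum) (rule fdd_coord_in)

end

section \<open>Uniform boundedness of the projections by Baire category\<close>

text \<open>If the closure contains a ball about \<open>x\<close>, then each small \<open>y\<close>
  is the midpoint of \<open>x + y\<close> and \<open>- (x - y)\<close>, both of which lie in the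
  closure by symmetry.\<close>

lemma symmetric_convex_closure_contains_ball:
  fixes A :: "'a::real_normed_vector set"
  assumes "convex A" "\<And>x. x \<in> A \<Longrightarrow> - x \<in> A" "interior (closure A) \<noteq> {}"
  obtains r where "r > 0" "ball 0 r \<subseteq> closure A"
proof -
  obtain x r where r: "r > 0" "ball x r \<subseteq> closure A"
    using assms(3) by (meson ex_in_conv mem_interior)
  have "uminus ` closure A = closure (uminus ` A)"
    using closure_scaleR[of "-1" A] by simp
  also have "uminus ` A = A"
    using assms(2) by (force simp: image_iff)
  finally have sym: "- y \<in> closure A" if "y \<in> closure A" for y
    using that by blast
  have "ball 0 r \<subseteq> closure A"
  proof
    fix y :: 'a assume "y \<in> ball 0 r"
    then have "x + y \<in> ball x r" "x - y \<in> ball x r"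
      by (simp_all add: dist_norm)
    then have "x + y \<in> closure A" "x - y \<in> closure A"
      using r(2) by blast+
    then have "(1/2) *\<^sub>R (x + y) + (1/2) *\<^sub>R (- (x - y)) \<in> closure A"
      by (intro convexD[OF convex_closure[OF assms(1)]] sym) simp_all
    moreover have "(1/2) *\<^sub>R (x + y) + (1/2) *\<^sub>R (- (x - y)) = y"
      by (simp add: algebra_simps flip: scaleR_add_left)
    ultimately show "y \<in> closure A" by simp
  qed
  then show thesis using r that by blast
qed

lemma Baire_closed_cover:
  fixes A :: "nat \<Rightarrow> 'a::complete_space set"
  assumes "\<And>n. closed (A n)" "(\<Union>n. A n) = UNIV"
  obtains n where "interior (A n) \<noteq> {}"
proof -
  have "Met_TC.mcomplete TYPE('a)"
    using complete_UNIV by (auto simp: Met_TC.mcomplete_def complete_def)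
  then have "interior (\<Union>n. A n) = {}" if "\<And>n. interior (A n) = {}"
    using Met_TC.metric_Baire_category_alt[of "range A"] assms that by auto
  then show thesis using assms(2) that by auto
qed

text \<open>The individual projections are not yet known to be continuous, so the argument follows
  the open mapping theorem. The closure of some \<open>A N\<close> contains a ball, and successive
  approximation writes each \<open>x\<close> in it as a series along which all projections decay
  geometrically. Uniqueness of the expansion of \<open>x\<close> then allows projecting term by
  term.\<close>

theorem fdd_proj_uniformly_bounded:
  fixes X :: "nat \<Rightarrow> 'a::banach set"
  assumes X: "fdd X"
  obtains C where "C > 0" "\<And>n x. norm (fdd_proj X n x) \<le> C * norm x"
proof -
  let ?P = "fdd_proj X"
  define A where "A N = {x. \<forall>n. norm (?P n x) \<le> real N}" for N
  have scale: "?P n (c *\<^sub>R x) = c *\<^sub>R ?P n x" for n c x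
    using linear_fdd_proj[OF X] by (rule linear_cmul)
  have add: "?P n (x + y) = ?P n x + ?P n y" for n x y
    using linear_fdd_proj[OF X] by (rule linear_add)
  have "x \<in> (\<Union>N. closure (A N))" for x
  proof -
    obtain M where "\<And>n. norm (?P n x) \<le> M"
      using convergent_imp_Bseq[OF convergentI[OF fdd_proj_tendsto[OF X]]] by (auto simp: Bseq_def)
    moreover obtain N where "M \<le> real N"
      using real_arch_simple by blast
    ultimately have "x \<in> A N"
      using order_trans unfolding A_def by blast
    then show ?thesis using closure_subset by blast
  qed
  then have "(\<Union>N. closure (A N)) = UNIV" by blast
  then obtain N where "interior (closure (A N)) \<noteq> {}"
    using Baire_closed_cover[of "\<lambda>N. closure (A N)"] by (metis closed_closure)
  moreover have "convex (A N)"
  proof (rule convexI)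
    fix x y u v assume *: "x \<in> A N" "y \<in> A N" and uv: "(0::real) \<le> u" "0 \<le> v" "u + v = 1"
    have "norm (?P n (u *\<^sub>R x + v *\<^sub>R y)) \<le> u * real N + v * real N" for n
      unfolding add scale
      by (rule norm_triangle_le) (use * uv in \<open>auto simp: A_def intro!: add_mono mult_left_mono\<close>)
    then show "u *\<^sub>R x + v *\<^sub>R y \<in> A N"
      using uv by (simp add: A_def flip: distrib_right)
  qed
  moreover have "- x \<in> A N" if "x \<in> A N" for x
    using that scale[of _ "-1" x] by (simp add: A_def)
  ultimately obtain r where r: "r > 0" "ball 0 r \<subseteq> closure (A N)"
    using symmetric_convex_closure_contains_ball by blast
  \<comment> \<open>Scaling by \<open>2 ^ k\<close> moves \<open>w\<close> into the ball, where an
    element of \<open>A N\<close> approximates it up to \<open>r / 2\<close>; \<open>z\<close> is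
    the error, scaled back.\<close>
  have approx: "\<exists>z. norm z < r / 2 ^ Suc k \<and> (\<forall>n. norm (?P n (w - z)) \<le> real N / 2 ^ k)"
    if "norm w < r / 2 ^ k" for w k
  proof -
    have "(2 ^ k) *\<^sub>R w \<in> closure (A N)"
      using that r by (intro subsetD[OF r(2)]) (simp add: field_simps)
    then obtain y where y: "y \<in> A N" "dist y ((2 ^ k) *\<^sub>R w) < r / 2"
      using r(1) closure_approachable[of _ "A N"] by (meson half_gt_zero)
    have "norm (w - (1 / 2 ^ k) *\<^sub>R y) = norm ((1 / 2 ^ k) *\<^sub>R ((2 ^ k) *\<^sub>R w - y))"
      by (simp add: scaleR_diff_right)
    also have "\<dots> = dist y ((2 ^ k) *\<^sub>R w) / 2 ^ k"
      by (simp add: dist_norm norm_minus_commute)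
    also have "\<dots> < r / 2 ^ Suc k"
      using y(2) by (simp add: field_simps)
    finally have "norm (w - (1 / 2 ^ k) *\<^sub>R y) < r / 2 ^ Suc k" .
    moreover have "norm (?P n (w - (w - (1 / 2 ^ k) *\<^sub>R y))) \<le> real N / 2 ^ k" for n
      using y(1) by (simp add: scale A_def divide_right_mono)
    ultimately show ?thesis by blast
  qed
  have bound: "norm (?P n x) \<le> 2 * real N" if x: "norm x < r" for n x
  proof -
    have "\<exists>w. \<forall>k. (norm (w k) < r / 2 ^ k \<and> (k = 0 \<longrightarrow> w k = x)) \<and>
        (\<forall>n. norm (?P n (w k - w (Suc k))) \<le> real N / 2 ^ k)"
      by (rule dependent_nat_choice) (use x approx in auto)
    then obtain w where w: "\<And>k. norm (w k) < r / 2 ^ k" "w 0 = x"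
      "\<And>k n. norm (?P n (w k - w (Suc k))) \<le> real N / 2 ^ k"
      by blast
    \<comment> \<open>As \<open>w\<close> tends to 0, these differences telescope to
      \<open>w 0 = x\<close>.\<close>
    define y where "y k = w k - w (Suc k)" for k
    have "(\<lambda>k. r / 2 ^ k) \<longlonglongrightarrow> 0"
      using tendsto_mult[OF tendsto_const[of r] LIMSEQ_power_zero[of "1/2 :: real"]]
      by (simp add: power_one_over)
    then have "w \<longlonglongrightarrow> 0"
      by (rule Lim_null_comparison[rotated]) (use w(1) in \<open>auto intro!: always_eventually less_imp_le\<close>)
    from telescope_sums'[OF this] have y_sums: "y sums x"
      unfolding y_def w(2) by simp
    have geo: "(\<lambda>k. real N / 2 ^ k) sums (2 * real N)"
      using sums_mult[OF geometric_sums[of "1/2 :: real"], of "real N"]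
      by (simp add: power_one_over mult.commute)
    have y_bound: "norm (?P n (y k)) \<le> real N / 2 ^ k" for n k
      using w(3) by (simp add: y_def)
    have summable: "summable (\<lambda>k. norm (?P n (y k)))" for n
      by (rule summable_comparison_test[OF _ sums_summable[OF geo]]) (use y_bound in auto)
    define p where "p n = (\<Sum>k. ?P n (y k))" for n
    have p_sums: "(\<lambda>k. ?P n (y k)) sums p n" for n
      unfolding p_def by (rule summable_sums[OF summable_norm_cancel[OF summable]])
    have coord: "(\<lambda>k. fdd_coord X i (y k)) sums (p (Suc i) - p i)" for i
      using sums_diff[OF p_sums[of "Suc i"] p_sums[of i]] by (simp add: fdd_proj_def)
    have p_sum: "(\<Sum>i<n. p (Suc i) - p i) = p n" for n
      by (simp add: sum_lessThan_telescope) (simp add: p_def fdd_proj_def)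
    \<comment> \<open>The limits in \<open>n\<close> and in the number of terms may be interchanged,
      since the series converges uniformly in \<open>n\<close>.\<close>
    have p_lim: "p \<longlonglongrightarrow> x"
    proof (rule swap_uniform_limit')
      show "\<forall>\<^sub>F m in sequentially. (\<lambda>n. \<Sum>k<m. ?P n (y k)) \<longlonglongrightarrow> (\<Sum>k<m. y k)"
        by (intro always_eventually allI tendsto_sum fdd_proj_tendsto X)
      show "(\<lambda>m. \<Sum>k<m. y k) \<longlonglongrightarrow> x"
        using y_sums by (simp add: sums_def)
      show "uniform_limit UNIV (\<lambda>m n. \<Sum>k<m. ?P n (y k)) p sequentially"
        unfolding p_def by (rule Weierstrass_m_test[OF y_bound sums_summable[OF geo]])
    qed auto
    \<comment> \<open>The increments of \<open>p\<close> sum to \<open>x\<close>, and closedness of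
      \<open>X i\<close> keeps them in the right summand, so they form the expansion of
      \<open>x\<close>.\<close>
    have "fdd_coord X i x = p (Suc i) - p i" for i
    proof (rule fdd_coord_unique[OF X])
      show "p (Suc i) - p i \<in> X i" for i
      proof (rule closed_sequentially[OF fdd_closed[OF X]])
        show "(\<lambda>m. \<Sum>k<m. fdd_coord X i (y k)) \<longlonglongrightarrow> p (Suc i) - p i"
          using coord by (simp add: sums_def)
        show "(\<Sum>k<m. fdd_coord X i (y k)) \<in> X i" for m
          by (intro subspace_sum fdd_subspace fdd_coord_in X)
      qed
    qed (simp add: p_sum p_lim)
    then have "?P n x = p n"
      using p_sum by (simp add: fdd_proj_def)
    also have "norm (p n) \<le> (\<Sum>k. norm (?P n (y k)))"
      unfolding p_def by (rule summable_norm[OF summable])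
    also have "\<dots> \<le> 2 * real N"
      using suminf_le[OF y_bound summable sums_summable[OF geo]] sums_unique[OF geo] by simp
    finally show ?thesis .
  qed
  show thesis
  proof
    \<comment> \<open>A nonzero \<open>x\<close> is rescaled to norm \<open>r / 2\<close>, where
      \<open>2 * real N\<close> is a bound; the added 1 keeps the constant positive for
      \<open>N = 0\<close>.\<close>
    show "4 * (real N + 1) / r > 0"
      using r by simp
    fix n x
    show "norm (?P n x) \<le> 4 * (real N + 1) / r * norm x"
    proof (cases "x = 0")
      case True
      then show ?thesis using scale[of n 0 0] by simp
    next
      case False
      define t where "t = r / (2 * norm x)"
      have t: "t > 0" using r False by (simp add: t_def)
      have "norm (t *\<^sub>R x) < r"
        using r False by (simp add: t_def)
      then have "t * norm (?P n x) \<le> 2 * real N"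
        using bound[of "t *\<^sub>R x" n] t by (simp add: scale)
      then show ?thesis
        using r False by (simp add: t_def field_simps add_increasing)
    qed
  qed
qed

section \<open>Radial truncation\<close>

text \<open>For \<open>s \<ge> 0\<close> this is the radial retraction onto the ball of radius
  \<open>s\<close>; writing it with \<open>sgn\<close> avoids a case distinction at 0.\<close>

definition clip :: "real \<Rightarrow> 'a::real_normed_vector \<Rightarrow> 'a" where
  "clip s v = min s (norm v) *\<^sub>R sgn v"

lemma norm_clip:
  assumes "s \<ge> 0"
  shows "norm (clip s v) = min s (norm v)"
  using assms by (cases "v = 0") (auto simp: clip_def norm_sgn)

lemma norm_scaleR_sgn: "norm v *\<^sub>R sgn v = (v::'a::real_normed_vector)"
  by (cases "v = 0") (simp_all add: sgn_div_norm)

lemma clip_eq: "norm v \<le> s \<Longrightarrow> clip s v = v"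
  by (simp add: clip_def norm_scaleR_sgn min_absorb2)

text \<open>The lengths contribute \<open>\<bar>s - t\<bar>\<close> and one
  \<open>norm (v - w)\<close>. Directions alone are not Lipschitz near 0, but weighted by
  \<open>norm w\<close> their difference is at most \<open>2 * norm (v - w)\<close>.\<close>

lemma norm_clip_diff_le:
  assumes "s \<ge> 0" "t \<ge> 0"
  shows "norm (clip s v - clip t w) \<le> \<bar>s - t\<bar> + 3 * norm (v - w)"
proof -
  have sgn_le: "norm (sgn u) \<le> 1" for u :: 'a
    by (simp add: norm_sgn)
  have vw: "\<bar>norm v - norm w\<bar> \<le> norm (v - w)"
    by (rule norm_triangle_ineq3)
  have "clip s v - clip t w =
      (min s (norm v) - min t (norm w)) *\<^sub>R sgn v + min t (norm w) *\<^sub>R (sgn v - sgn w)"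
    by (simp add: clip_def algebra_simps)
  also have "norm \<dots> \<le> \<bar>min s (norm v) - min t (norm w)\<bar> + min t (norm w) * norm (sgn v - sgn w)"
    by (rule norm_triangle_le)
      (use assms sgn_le in \<open>auto intro!: add_mono mult_left_le simp: abs_of_nonneg\<close>)
  also have "\<bar>min s (norm v) - min t (norm w)\<bar> \<le> \<bar>s - t\<bar> + norm (v - w)"
    using vw by linarith
  also have "min t (norm w) * norm (sgn v - sgn w) \<le> norm w * norm (sgn v - sgn w)"
    by (intro mult_right_mono) auto
  also have "norm w * norm (sgn v - sgn w) = norm (norm w *\<^sub>R sgn v - norm w *\<^sub>R sgn w)"
    by (simp flip: scaleR_diff_right)
  also have "norm w *\<^sub>R sgn v - norm w *\<^sub>R sgn w = (norm w - norm v) *\<^sub>R sgn v + (v - w)"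
    by (simp add: norm_scaleR_sgn algebra_simps)
  also have "norm \<dots> \<le> \<bar>norm w - norm v\<bar> + norm (v - w)"
    by (rule norm_triangle_le) (use sgn_le in \<open>auto intro!: mult_left_le\<close>)
  finally show ?thesis
    using vw by linarith
qed

section \<open>The weighted body and its Lipschitz retraction\<close>

text \<open>The growth \<open>b_ge\<close> makes tails uniformly small, which gives compactness, and
  puts the body into the unit ball. The bound \<open>sum_b_le\<close> makes the Lipschitz constants
  of the truncations independent of the stage.\<close>

locale weighted_fdd =
  fixes X :: "nat \<Rightarrow> 'a::banach set" and b :: "nat \<Rightarrow> real" and C :: real
  assumes X: "fdd X"
    and C_pos: "C > 0"
    and proj_le: "norm (fdd_proj X n x) \<le> C * norm x"
    and b_ge: "2 ^ n \<le> b n"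
    and sum_b_le: "(\<Sum>i<n. b i) \<le> b n"
begin

abbreviation coord :: "nat \<Rightarrow> 'a \<Rightarrow> 'a" where "coord \<equiv> fdd_coord X"
abbreviation proj :: "nat \<Rightarrow> 'a \<Rightarrow> 'a" where "proj \<equiv> fdd_proj X"

definition cost :: "nat \<Rightarrow> 'a \<Rightarrow> real" where
  "cost n x = (\<Sum>i<n. b i * norm (coord i x))"

definition body :: "'a set" where
  "body = {x. \<forall>n. cost n x \<le> 1}"

text \<open>While \<open>cost n x \<le> 1\<close>, this is the largest norm that coordinate
  \<open>n\<close> can have within the budget. Cutting off at 0 makes \<open>stopped n\<close>
  Lipschitz on the whole space, also at points that overrun the budget earlier.\<close>

definition budget :: "nat \<Rightarrow> 'a \<Rightarrow> real" where
  "budget n x = max 0 ((1 - cost n x) / b n)"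

definition stopped :: "nat \<Rightarrow> 'a \<Rightarrow> 'a" where
  "stopped n x = proj n x + clip (budget n x) (coord n x)"

definition retr :: "'a \<Rightarrow> 'a" where
  "retr x = (if x \<in> body then x else stopped (LEAST n. cost (Suc n) x > 1) x)"

lemma b_pos: "b n > 0"
  using b_ge[of n] by (smt (verit) zero_less_power)

lemma b_nonneg: "0 \<le> b n"
  using b_pos less_imp_le by blast

lemma b_Suc_ge: "b n \<le> b (Suc n)"
proof -
  have "b n \<le> (\<Sum>i<Suc n. b i)"
    using b_nonneg by (simp add: sum_nonneg)
  then show ?thesis using sum_b_le[of "Suc n"] by linarith
qed

lemma b_mono: "m \<le> n \<Longrightarrow> b m \<le> b n"
  using b_Suc_ge by (rule lift_Suc_mono_le)

lemma coord_diff: "coord i (x - y) = coord i x - coord i y"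
  and coord_add: "coord i (x + y) = coord i x + coord i y"
  and coord_scale: "coord i (c *\<^sub>R x) = c *\<^sub>R coord i x"
  using linear_fdd_coord[OF X] by (simp_all add: linear_diff linear_add linear_cmul)

lemma proj_diff: "proj n (x - y) = proj n x - proj n y"
  using linear_fdd_proj[OF X] by (simp add: linear_diff)

lemma coord_le: "norm (coord i x) \<le> 2 * C * norm x"
proof -
  have "coord i x = proj (Suc i) x - proj i x"
    by (simp add: fdd_proj_def)
  also have "norm \<dots> \<le> C * norm x + C * norm x"
    by (rule order_trans[OF norm_triangle_ineq4 add_mono[OF proj_le proj_le]])
  finally show ?thesis by simp
qed

lemma cost_mono: "m \<le> n \<Longrightarrow> cost m x \<le> cost n x"
  unfolding cost_def using b_nonneg by (intro sum_mono2) auto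

lemma cost_nonneg: "cost n x \<ge> 0"
  unfolding cost_def using b_nonneg by (intro sum_nonneg) auto

lemma cost_cong: "(\<And>i. i < n \<Longrightarrow> coord i x = coord i y) \<Longrightarrow> cost n x = cost n y"
  by (simp add: cost_def)

text \<open>Each coordinate is \<open>2 * C\<close>-Lipschitz, and the weights before
  \<open>n\<close> add up to at most \<open>b n\<close>. This factor cancels in
  \<open>budget\<close>, where the cost is divided by \<open>b n\<close>.\<close>

lemma cost_diff_le: "\<bar>cost n x - cost n y\<bar> \<le> 2 * C * b n * norm (x - y)"
proof -
  have "\<bar>cost n x - cost n y\<bar> = \<bar>\<Sum>i<n. b i * (norm (coord i x) - norm (coord i y))\<bar>"
    by (simp add: cost_def algebra_simps sum_subtractf)
  also have "\<dots> \<le> (\<Sum>i<n. \<bar>b i * (norm (coord i x) - norm (coord i y))\<bar>)"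
    by (rule sum_abs)
  also have "\<dots> \<le> (\<Sum>i<n. b i * (2 * C * norm (x - y)))"
  proof (rule sum_mono)
    fix i
    have "\<bar>norm (coord i x) - norm (coord i y)\<bar> \<le> norm (coord i (x - y))"
      unfolding coord_diff by (rule norm_triangle_ineq3)
    also have "\<dots> \<le> 2 * C * norm (x - y)"
      by (rule coord_le)
    finally show "\<bar>b i * (norm (coord i x) - norm (coord i y))\<bar> \<le> b i * (2 * C * norm (x - y))"
      using b_pos[of i] by (simp add: abs_mult)
  qed
  also have "\<dots> = (\<Sum>i<n. b i) * (2 * C * norm (x - y))"
    by (simp add: sum_distrib_right)
  also have "\<dots> \<le> b n * (2 * C * norm (x - y))"
    using C_pos by (intro mult_right_mono sum_b_le) auto
  finally show ?thesis by (simp add: algebra_simps)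
qed

text \<open>Beyond \<open>m\<close> every unit of norm costs at least \<open>b m\<close>, and only
  \<open>1 - cost m x\<close> is left to spend.\<close>

lemma body_tail_le:
  assumes "x \<in> body"
  shows "norm (x - proj m x) \<le> (1 - cost m x) / b m"
proof (rule tendsto_upperbound)
  show "(\<lambda>n. norm (proj n x - proj m x)) \<longlonglongrightarrow> norm (x - proj m x)"
    by (intro tendsto_intros fdd_proj_tendsto X)
  have "norm (proj n x - proj m x) \<le> (1 - cost m x) / b m" if "n \<ge> m" for n
  proof -
    have split: "(\<Sum>i<n. f i) = (\<Sum>i<m. f i) + (\<Sum>i=m..<n. f i)" for f :: "nat \<Rightarrow> 'c::comm_monoid_add"
      using that by (metis lessThan_atLeast0 sum.atLeastLessThan_concat zero_le)
    have "b m * norm (proj n x - proj m x) = b m * norm (\<Sum>i=m..<n. coord i x)"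
      by (simp add: fdd_proj_def split)
    also have "\<dots> \<le> (\<Sum>i=m..<n. b m * norm (coord i x))"
      using b_pos[of m] by (simp add: sum_norm_le flip: sum_distrib_left)
    also have "\<dots> \<le> (\<Sum>i=m..<n. b i * norm (coord i x))"
      by (intro sum_mono mult_right_mono b_mono) auto
    also have "\<dots> = cost n x - cost m x"
      by (simp add: cost_def split)
    also have "\<dots> \<le> 1 - cost m x"
      using assms by (simp add: body_def)
    finally show ?thesis
      using b_pos[of m] by (simp add: field_simps)
  qed
  then show "\<forall>\<^sub>F n in sequentially. norm (proj n x - proj m x) \<le> (1 - cost m x) / b m"
    by (auto simp: eventually_sequentially)
qed simp

lemma budget_diff_le: "\<bar>budget n x - budget n y\<bar> \<le> 2 * C * norm (x - y)"
proof -
  have "\<bar>max 0 s - max 0 t\<bar> \<le> \<bar>s - t\<bar>" for s t :: real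
    by linarith
  then have "\<bar>budget n x - budget n y\<bar> \<le> \<bar>(1 - cost n x) / b n - (1 - cost n y) / b n\<bar>"
    unfolding budget_def by blast
  also have "(1 - cost n x) / b n - (1 - cost n y) / b n = (cost n y - cost n x) / b n"
    by (simp add: diff_divide_distrib)
  also have "\<bar>\<dots>\<bar> = \<bar>cost n x - cost n y\<bar> / b n"
    using b_pos[of n] by (simp add: abs_divide abs_minus_commute)
  also have "\<dots> \<le> 2 * C * norm (x - y)"
    using cost_diff_le[of n x y] b_pos[of n] by (simp add: field_simps)
  finally show ?thesis .
qed

lemma stopped_diff_le: "norm (stopped n x - stopped n y) \<le> 9 * C * norm (x - y)"
proof -
  have "stopped n x - stopped n y = proj n (x - y) +
      (clip (budget n x) (coord n x) - clip (budget n y) (coord n y))"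
    by (simp add: stopped_def proj_diff)
  \<comment> \<open>The constant 9 arises as 1 from the projection, 2 from the budget, and 3 times 2
    from clipping the coordinate.\<close>
  also have "norm \<dots> \<le> C * norm (x - y) + (2 * C * norm (x - y) + 3 * (2 * C * norm (x - y)))"
  proof (rule norm_triangle_le, rule add_mono[OF proj_le])
    have "norm (clip (budget n x) (coord n x) - clip (budget n y) (coord n y))
        \<le> \<bar>budget n x - budget n y\<bar> + 3 * norm (coord n x - coord n y)"
      by (rule norm_clip_diff_le) (auto simp: budget_def)
    also have "\<dots> \<le> 2 * C * norm (x - y) + 3 * (2 * C * norm (x - y))"
      using budget_diff_le coord_le[of n "x - y"] by (intro add_mono mult_left_mono) (auto simp: coord_diff)
    finally show "norm (clip (budget n x) (coord n x) - clip (budget n y) (coord n y))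
        \<le> 2 * C * norm (x - y) + 3 * (2 * C * norm (x - y))" .
  qed
  finally show ?thesis by simp
qed

lemma clip_in:
  assumes "v \<in> X n"
  shows "clip s v \<in> X n"
  unfolding clip_def sgn_div_norm using assms fdd_subspace[OF X] by (intro subspace_scale)

lemma coord_stopped:
  "coord i (stopped n x) =
     (if i < n then coord i x else if i = n then clip (budget n x) (coord n x) else 0)"
  using fdd_coord_eq[OF X clip_in[OF fdd_coord_in[OF X, of n x]], of i "budget n x"]
  by (auto simp: stopped_def coord_add fdd_coord_proj[OF X])

lemma stopped_eq_proj:
  assumes "cost (Suc n) x \<le> 1"
  shows "stopped n x = proj (Suc n) x"
proof -
  have "b n * norm (coord n x) \<le> 1 - cost n x"
    using assms by (simp add: cost_def)
  then have "norm (coord n x) \<le> (1 - cost n x) / b n"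
    using b_pos[of n] by (simp add: pos_le_divide_eq mult.commute)
  then have "norm (coord n x) \<le> budget n x"
    unfolding budget_def by simp
  then show ?thesis
    by (simp add: stopped_def clip_eq fdd_proj_def)
qed

lemma stopped_in_body:
  assumes "cost n x \<le> 1"
  shows "stopped n x \<in> body"
  unfolding body_def
proof safe
  fix k
  let ?h = "stopped n x"
  \<comment> \<open>All coordinates after \<open>n\<close> vanish, so the cost stays constant from
    \<open>Suc n\<close> on.\<close>
  have "cost (k + Suc n) ?h = cost (Suc n) ?h"
    by (induction k) (simp_all add: cost_def coord_stopped)
  moreover have "cost (Suc n) ?h = cost n ?h + b n * norm (coord n ?h)"
    by (simp add: cost_def)
  moreover have "cost n ?h = cost n x"
    by (rule cost_cong) (simp add: coord_stopped)
  moreover have "b n * norm (coord n ?h) \<le> 1 - cost n x"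
  proof -
    have "norm (coord n ?h) \<le> budget n x"
      by (simp add: coord_stopped norm_clip budget_def)
    also have "\<dots> = (1 - cost n x) / b n"
      using assms b_pos[of n] by (simp add: budget_def)
    finally show ?thesis
      using b_pos[of n] by (simp add: field_simps)
  qed
  moreover have "cost k ?h \<le> cost (k + Suc n) ?h"
    by (rule cost_mono) simp
  ultimately show "cost k ?h \<le> 1"
    by linarith
qed

lemma not_body_stops:
  assumes "x \<notin> body"
  obtains n where "cost n x \<le> 1" "cost (Suc n) x > 1" "retr x = stopped n x"
proof -
  define n where "n = (LEAST n. cost (Suc n) x > 1)"
  obtain k where "cost k x > 1"
    using assms by (auto simp: body_def not_le)
  then have "cost (Suc k) x > 1"
    using cost_mono[of k "Suc k" x] by simp
  then have "cost (Suc n) x > 1"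
    unfolding n_def by (rule LeastI)
  \<comment> \<open>The least index refers to \<open>cost (Suc n) x\<close>, so minimality is
    applied to the predecessor of \<open>n\<close>; \<open>cost 0 x\<close> is an empty sum.\<close>
  moreover have "cost n x \<le> 1"
  proof (cases n)
    case 0
    then show ?thesis by (simp add: cost_def)
  next
    case (Suc j)
    then show ?thesis
      using not_less_Least[of j "\<lambda>n. cost (Suc n) x > 1"] n_def by fastforce
  qed
  ultimately show thesis
    using that assms by (simp add: retr_def n_def)
qed

lemma retr_in_body: "retr x \<in> body"
proof (cases "x \<in> body")
  case False
  then show ?thesis
    by (rule not_body_stops) (simp add: stopped_in_body)
qed (simp add: retr_def)

text \<open>By monotonicity of the cost, a point still within budget at \<open>n\<close> is stopped
  at some stage \<open>m \<ge> n\<close>, which leaves the earlier coordinates untouched.\<close>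

lemma retr_coord:
  assumes "cost n x \<le> 1" "i < n"
  shows "coord i (retr x) = coord i x"
proof (cases "x \<in> body")
  case False
  then obtain m where m: "cost (Suc m) x > 1" "retr x = stopped m x"
    using not_body_stops by blast
  have "n \<le> m"
    using m(1) assms(1) cost_mono[of "Suc m" n x] by (meson leD le_less_trans not_less_eq_eq)
  then show ?thesis
    using assms m by (simp add: coord_stopped)
qed (simp add: retr_def)

text \<open>If \<open>x\<close> is stopped at stage \<open>n\<close> while \<open>y\<close> is not, what \<open>retr y\<close> keeps after stage \<open>n\<close>
  is paid for by the part of its budget left at that stage, which is at most
  \<open>cost (Suc n) x - cost (Suc n) y\<close>.\<close>
lemma retr_diff_le_aux:
  assumes "cost (Suc n) x > 1" "cost (Suc n) y \<le> 1" "retr x = stopped n x"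
  shows "norm (retr x - retr y) \<le> 11 * C * norm (x - y)"
proof -
  let ?n = "Suc n"
  have proj: "proj ?n (retr y) = proj ?n y"
    unfolding fdd_proj_def using retr_coord[OF assms(2)] by (intro sum.cong) auto
  have "cost ?n (retr y) = cost ?n y"
    using retr_coord[OF assms(2)] by (intro cost_cong)
  then have "norm (retr y - proj ?n y) \<le> (1 - cost ?n y) / b ?n"
    using body_tail_le[OF retr_in_body, of y ?n] proj by simp
  also have "\<dots> \<le> \<bar>cost ?n x - cost ?n y\<bar> / b ?n"
    using assms b_pos[of ?n] by (intro divide_right_mono) auto
  also have "\<dots> \<le> 2 * C * norm (x - y)"
    using cost_diff_le[of ?n x y] b_pos[of ?n] by (simp add: field_simps)
  \<comment> \<open>Since \<open>stopped n y\<close> is \<open>proj (Suc n) y\<close>, it serves as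
    intermediate point, and the constants 2 and 9 add up to 11.\<close>
  finally have "norm (retr y - stopped n y) \<le> 2 * C * norm (x - y)"
    using stopped_eq_proj[OF assms(2)] by simp
  moreover have "norm (retr x - stopped n y) \<le> 9 * C * norm (x - y)"
    using stopped_diff_le assms(3) by simp
  ultimately show ?thesis
    using norm_triangle_ineq4[of "retr x - stopped n y" "retr y - stopped n y"] by simp
qed

text \<open>The point stopped first plays the role of \<open>x\<close> in
  \<open>retr_diff_le_aux\<close>, points of the body counting as never stopped; equal stages are
  compared by \<open>stopped_diff_le\<close>. The summand 1 covers two points of the body, where
  \<open>retr\<close> is the identity.\<close>

lemma retr_diff_le: "norm (retr x - retr y) \<le> (11 * C + 1) * norm (x - y)"
proof -
  have le: "11 * C * norm (x - y) \<le> (11 * C + 1) * norm (x - y)"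
    by (simp add: algebra_simps)
  have one: "norm (retr x - retr y) \<le> 11 * C * norm (x - y)"
    if xy: "x \<notin> body" "y \<in> body" for x y
  proof -
    obtain n where "cost (Suc n) x > 1" "retr x = stopped n x"
      using not_body_stops[OF xy(1)] by blast
    moreover have "cost (Suc n) y \<le> 1"
      using xy(2) by (simp add: body_def)
    ultimately show ?thesis by (intro retr_diff_le_aux)
  qed
  consider "x \<in> body" "y \<in> body" | "x \<notin> body" "y \<in> body" | "x \<in> body" "y \<notin> body"
    | "x \<notin> body" "y \<notin> body" by blast
  then show ?thesis
  proof cases
    case 1
    then show ?thesis using C_pos by (simp add: retr_def algebra_simps)
  next
    case 2
    then show ?thesis using one le by (meson order_trans)
  next
    case 3
    then show ?thesis using one[of y x] le by (simp add: norm_minus_commute)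
  next
    case 4
    obtain m where m: "cost m x \<le> 1" "cost (Suc m) x > 1" "retr x = stopped m x"
      using not_body_stops[OF 4(1)] by blast
    obtain n where n: "cost n y \<le> 1" "cost (Suc n) y > 1" "retr y = stopped n y"
      using not_body_stops[OF 4(2)] by blast
    have "norm (retr x - retr y) \<le> 11 * C * norm (x - y)"
    proof (cases m n rule: linorder_cases)
      case less
      then have "cost (Suc m) y \<le> 1"
        using n(1) cost_mono[of "Suc m" n y] by simp
      then show ?thesis using retr_diff_le_aux m by blast
    next
      case equal
      have "9 * C * norm (x - y) \<le> 11 * C * norm (x - y)"
        using C_pos by (intro mult_right_mono) auto
      then show ?thesis
        using equal m n stopped_diff_le[of m x y] by simp
    next
      case greater
      then have "cost (Suc n) x \<le> 1"
        using m(1) cost_mono[of "Suc n" m x] by simp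
      then show ?thesis
        using retr_diff_le_aux[of n y x] n by (simp add: norm_minus_commute)
    qed
    then show ?thesis using le by linarith
  qed
qed

lemma lipschitz_retraction_onto_body: "lipschitz_retraction_onto body retr"
  unfolding lipschitz_retraction_onto_def
proof (intro conjI exI)
  show "(11 * C + 1)-lipschitz_on UNIV retr"
    using C_pos retr_diff_le by (intro lipschitz_onI) (auto simp: dist_norm)
qed (use retr_in_body in \<open>auto simp: retr_def\<close>)

lemma convex_body: "convex body"
proof (rule convexI)
  fix x y and u v :: real
  assume xy: "x \<in> body" "y \<in> body" and uv: "0 \<le> u" "0 \<le> v" "u + v = 1"
  have "cost n (u *\<^sub>R x + v *\<^sub>R y) \<le> 1" for n
  proof -
    have "cost n (u *\<^sub>R x + v *\<^sub>R y) \<le> (\<Sum>i<n. b i * (u * norm (coord i x) + v * norm (coord i y)))"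
      unfolding cost_def coord_add coord_scale using b_nonneg uv
      by (intro sum_mono mult_left_mono norm_triangle_le) auto
    also have "\<dots> = u * cost n x + v * cost n y"
      by (simp add: cost_def sum_distrib_left sum.distrib algebra_simps)
    also have "\<dots> \<le> u * 1 + v * 1"
      using xy uv by (intro add_mono mult_left_mono) (auto simp: body_def)
    finally show ?thesis using uv by simp
  qed
  then show "u *\<^sub>R x + v *\<^sub>R y \<in> body"
    by (simp add: body_def)
qed

lemma closed_body: "closed body"
proof -
  have "continuous_on UNIV (cost n)" for n
  proof (rule lipschitz_on_continuous_on)
    show "(2 * C * b n)-lipschitz_on UNIV (cost n)"
      using C_pos b_pos[of n] cost_diff_le[of n]
      by (intro lipschitz_onI) (auto simp: dist_norm)
  qed
  then have "closed {x. cost n x \<le> 1}" for n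
    by (intro closed_Collect_le) auto
  moreover have "body = (\<Inter>n. {x. cost n x \<le> 1})"
    by (auto simp: body_def)
  ultimately show ?thesis by auto
qed

text \<open>This is the tail estimate at \<open>m = 0\<close>, where projection and cost vanish and
  \<open>b 0 \<ge> 1\<close>.\<close>

lemma norm_body_le: "x \<in> body \<Longrightarrow> norm x \<le> 1"
  using body_tail_le[of x 0] b_ge[of 0] order_trans[of "norm x" "1 / b 0" 1]
  by (simp add: fdd_proj_def cost_def)

lemma bounded_body: "bounded body"
  using norm_body_le boundedI by blast

lemma body_tail_le_inverse:
  assumes "x \<in> body"
  shows "norm (x - proj m x) \<le> 1 / b m"
proof -
  have "(1 - cost m x) / b m \<le> 1 / b m"
    using cost_nonneg[of m x] b_pos[of m] by (intro divide_right_mono) auto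
  then show ?thesis using body_tail_le[OF assms, of m] by linarith
qed

end

section \<open>A fundamental sequence adapted to the FDD\<close>

text \<open>The finite concatenations \<open>L n\<close> are prefixes of one another, and
  \<open>\<beta>\<close> reads off their common infinite extension. Nonempty blocks make
  \<open>\<sigma>\<close> strictly increasing, so that \<open>L (Suc k)\<close> is long enough to
  have an entry \<open>k\<close>.\<close>

lemma enumerate_concat:
  fixes l :: "nat \<Rightarrow> 'b list"
  assumes "\<And>n. l n \<noteq> []"
  obtains \<beta> :: "nat \<Rightarrow> 'b" and \<sigma> :: "nat \<Rightarrow> nat"
  where "strict_mono \<sigma>" "\<And>n. \<beta> ` {..<\<sigma> n} = (\<Union>i<n. set (l i))"
proof -
  define L where "L n = concat (map l [0..<n])" for n
  define \<sigma> where "\<sigma> n = length (L n)" for n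
  define \<beta> where "\<beta> k = L (Suc k) ! k" for k
  have "\<sigma> n < \<sigma> (Suc n)" for n
    using assms[of n] by (simp add: \<sigma>_def L_def)
  then have mono: "strict_mono \<sigma>"
    by (simp add: strict_mono_Suc_iff)
  have nth_L: "L n ! k = L m ! k" if "m \<le> n" "k < \<sigma> m" for m n k
  proof -
    have "[0..<n] = [0..<m] @ [m..<n]"
      using that(1) by (metis le_add_diff_inverse upt_add_eq_append zero_le)
    then show ?thesis
      using that(2) by (simp add: L_def \<sigma>_def nth_append)
  qed
  have "\<beta> k = L n ! k" if "k < \<sigma> n" for k n
  proof -
    have "k < \<sigma> (Suc k)"
      using strict_mono_imp_increasing[OF mono, of "Suc k"] by simp
    then show ?thesis
      unfolding \<beta>_def using nth_L[of n "Suc k" k] nth_L[of "Suc k" n k] that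
      by (cases "n \<le> Suc k") auto
  qed
  then have "\<beta> ` {..<\<sigma> n} = (\<lambda>k. L n ! k) ` {..<\<sigma> n}" for n
    by (intro image_cong) auto
  also have "\<dots> n = set (L n)" for n
    by (auto simp: set_conv_nth \<sigma>_def)
  also have "\<dots> n = (\<Union>i<n. set (l i))" for n
    by (auto simp: L_def)
  finally show thesis using mono that by blast
qed

lemma fdd_enumeration:
  fixes X :: "nat \<Rightarrow> 'a::real_normed_vector set"
  assumes "fdd X"
  obtains \<beta> :: "nat \<Rightarrow> 'a" and \<sigma> :: "nat \<Rightarrow> nat"
  where "strict_mono \<sigma>" "\<And>n. initial_span \<beta> (\<sigma> n) = span (\<Union>i<n. X i)"
proof -
  have "\<exists>l. span (set l) = X n" for n
    using fdd_finite_dim[OF assms, of n] finite_list by metis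
  then obtain l where l: "\<And>n. span (set (l n)) = X n"
    by metis
  have "l n \<noteq> []" for n
    using l[of n] fdd_nontrivial[OF assms, of n] by (metis list.set(1) span_empty)
  then obtain \<beta> :: "nat \<Rightarrow> 'a" and \<sigma> :: "nat \<Rightarrow> nat"
    where \<sigma>: "strict_mono \<sigma>" "\<And>n. \<beta> ` {..<\<sigma> n} = (\<Union>i<n. set (l i))"
    by (rule enumerate_concat[of l]) (rule that)
  have "span (\<Union>i<n. set (l i)) = span (\<Union>i<n. X i)" for n
  proof (rule antisym)
    show "span (\<Union>i<n. set (l i)) \<subseteq> span (\<Union>i<n. X i)"
      using l span_superset by (intro span_mono) blast
    have "X i \<subseteq> span (\<Union>i<n. set (l i))" if "i < n" for i
      using that unfolding l[symmetric] by (intro span_mono) auto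
    then show "span (\<Union>i<n. X i) \<subseteq> span (\<Union>i<n. set (l i))"
      by (intro span_minimal subspace_span) auto
  qed
  then have "initial_span \<beta> (\<sigma> n) = span (\<Union>i<n. X i)" for n
    by (simp add: initial_span_def \<sigma>(2))
  with \<sigma>(1) show thesis
    by (rule that)
qed

lemma fdd_closed_span:
  assumes "fdd X"
  shows "closed (span (\<Union>i<n. X i))"
    and "\<exists>D. compact D \<and> span (\<Union>i<n. X i) \<inter> cball 0 M \<subseteq> D"
proof -
  obtain \<beta> \<sigma> where "initial_span \<beta> (\<sigma> n) = span (\<Union>i<n. X i)"
    using fdd_enumeration[OF assms] by metis
  then have B: "finite (\<beta> ` {..<\<sigma> n})" "span (\<beta> ` {..<\<sigma> n}) = span (\<Union>i<n. X i)"
    by (simp_all add: initial_span_def)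
  show "closed (span (\<Union>i<n. X i))"
    using finite_span_bounded_in_compact(2)[OF B(1)] unfolding B(2) .
  show "\<exists>D. compact D \<and> span (\<Union>i<n. X i) \<inter> cball 0 M \<subseteq> D"
    using finite_span_bounded_in_compact(1)[OF B(1), of M] unfolding B(2) by blast
qed

lemma fdd_proj_in_span:
  assumes "fdd X"
  shows "fdd_proj X n x \<in> span (\<Union>i<n. X i)"
  unfolding fdd_proj_def using fdd_coord_in[OF assms] by (intro span_sum span_base) auto

lemma fdd_coord_span:
  assumes "fdd X" "x \<in> span (\<Union>i<n. X i)" "i \<ge> n"
  shows "fdd_coord X i x = 0"
  using assms(2)
proof (induction rule: span_induct)
  case base
  show ?case
    using linear_fdd_coord[OF assms(1)] by (rule linear_subspace_kernel)
next
  case (step x)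
  then show ?case
    using fdd_coord_eq[OF assms(1)] assms(3) by fastforce
qed

text \<open>Serves twice: for the closed span of the body and for the fundamental sequence.\<close>

lemma fdd_dense_span:
  assumes "fdd X" "\<And>i. X i \<subseteq> span S"
  shows "closure (span S) = UNIV"
proof -
  have "fdd_proj X n x \<in> span S" for n x
    unfolding fdd_proj_def using fdd_coord_in[OF assms(1)] assms(2) by (intro span_sum) blast
  then have "x \<in> closure (span S)" for x
    unfolding closure_sequential using fdd_proj_tendsto[OF assms(1), of x]
    by (intro exI[of _ "\<lambda>n. fdd_proj X n x"]) simp
  then show ?thesis by blast
qed

section \<open>Compactness, height and inner radius of the body\<close>

context weighted_fdd
begin

lemma scaled_in_body:
  assumes "v \<in> X i" "b i * norm v \<le> 1"
  shows "v \<in> body"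
proof -
  have "cost n v = (if i < n then b i * norm v else 0)" for n
    unfolding cost_def fdd_coord_eq[OF X assms(1)] by (simp add: if_distrib cong: if_cong)
  then show ?thesis
    using assms(2) by (simp add: body_def)
qed

lemma body_element_exists:
  obtains v where "v \<in> X i" "v \<noteq> 0" "v \<in> body"
proof -
  obtain v where v: "v \<in> X i" "v \<noteq> 0"
    using fdd_nontrivial[OF X, of i] subspace_0[OF fdd_subspace[OF X, of i]] by blast
  let ?v = "(1 / (b i * norm v)) *\<^sub>R v"
  have "?v \<in> X i"
    using v fdd_subspace[OF X] by (intro subspace_scale)
  moreover have "?v \<noteq> 0"
    using v b_pos[of i] by simp
  moreover have "?v \<in> body"
    by (rule scaled_in_body) (use v b_pos[of i] calculation(1) in auto)
  ultimately show thesis using that by blast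
qed

lemma in_span_body: "X i \<subseteq> span body"
proof
  fix v assume v: "v \<in> X i"
  show "v \<in> span body"
  proof (cases "v = 0")
    case False
    have "(1 / (b i * norm v)) *\<^sub>R v \<in> body"
      by (rule scaled_in_body)
        (use False v b_pos[of i] fdd_subspace[OF X] in \<open>auto intro: subspace_scale\<close>)
    then have "(b i * norm v) *\<^sub>R ((1 / (b i * norm v)) *\<^sub>R v) \<in> span body"
      by (intro span_scale span_base)
    then show ?thesis
      using False b_pos[of i] by simp
  qed (simp add: span_zero)
qed

text \<open>The body is closed in a complete space. It is totally bounded because
  \<open>proj m\<close> moves its points by at most \<open>1 / b m\<close>, which tends to 0, into a
  bounded part of a finite dimensional subspace.\<close>

lemma compact_body: "compact body"
  unfolding compact_eq_totally_bounded
proof (intro conjI allI impI)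
  show "complete body"
    using closed_body by (simp add: complete_eq_closed)
  fix e :: real assume e: "e > 0"
  obtain m where "(1/2) ^ m < e / 2"
    using real_arch_pow_inv[of "e/2" "1/2"] e by auto
  moreover have "1 / b m \<le> (1/2) ^ m"
    using b_ge[of m] b_pos[of m] by (simp add: power_one_over frac_le)
  ultimately have m: "1 / b m < e / 2" by linarith
  \<comment> \<open>Radius \<open>C\<close> suffices, since the body lies in the unit ball.\<close>
  obtain D where D: "compact D" "span (\<Union>i<m. X i) \<inter> cball 0 C \<subseteq> D"
    using fdd_closed_span(2)[OF X] by blast
  then obtain k where k: "finite k" "D \<subseteq> (\<Union>x\<in>k. ball x (e / 2))"
    using compact_eq_totally_bounded[of D] e by (meson half_gt_zero)
  have "body \<subseteq> (\<Union>x\<in>k. ball x e)"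
  proof
    fix x assume x: "x \<in> body"
    have "C * norm x \<le> C"
      using norm_body_le[OF x] C_pos by simp
    then have "norm (proj m x) \<le> C"
      using proj_le[of m x] by linarith
    then have "proj m x \<in> D"
      using D fdd_proj_in_span[OF X] by auto
    then obtain z where z: "z \<in> k" "dist z (proj m x) < e / 2"
      using k by auto
    have "dist (proj m x) x < e / 2"
      using body_tail_le_inverse[OF x, of m] m by (simp add: dist_norm norm_minus_commute)
    then have "dist z x < e"
      using z dist_triangle_half_r[of "proj m x" z e x] by (simp add: dist_commute)
    then show "x \<in> (\<Union>x\<in>k. ball x e)"
      using z by auto
  qed
  then show "\<exists>k. finite k \<and> body \<subseteq> (\<Union>x\<in>k. ball x e)"
    using k by blast
qed

lemma gccr_body: "gccr body"
  unfolding gccr_def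
  using convex_body compact_body fdd_dense_span[OF X in_span_body] lipschitz_retraction_onto_body
  by blast

text \<open>The upper bound is the tail estimate. For positivity, the body contains a nonzero vector
  of \<open>X n\<close>, which lies outside the closed span of the earlier summands.\<close>

lemma height_body:
  assumes E: "initial_span \<beta> k = span (\<Union>i<n. X i)"
  shows "height \<beta> body k \<le> ennreal (1 / b n)" and "height \<beta> body k > 0"
proof -
  show "height \<beta> body k \<le> ennreal (1 / b n)"
    unfolding height_def E
  proof (intro SUP_least ennreal_leI)
    fix x assume "x \<in> body"
    then have "dist x (proj n x) \<le> 1 / b n"
      by (simp add: dist_norm body_tail_le_inverse)
    then show "infdist x (span (\<Union>i<n. X i)) \<le> 1 / b n"
      by (rule infdist_le2[OF fdd_proj_in_span[OF X]])
  qed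
  obtain v where v: "v \<in> X n" "v \<noteq> 0" "v \<in> body"
    by (rule body_element_exists)
  have "v \<notin> span (\<Union>i<n. X i)"
    using fdd_coord_span[OF X, of v n n] fdd_coord_eq[OF X v(1), of n] v(2) by auto
  then have "infdist v (span (\<Union>i<n. X i)) > 0"
    using fdd_closed_span(1)[OF X] span_zero by (intro infdist_pos_not_in_closed) auto
  then have "0 < ennreal (infdist v (initial_span \<beta> k))"
    by (simp add: E)
  also have "\<dots> \<le> height \<beta> body k"
    unfolding height_def using v by (intro SUP_upper)
  finally show "height \<beta> body k > 0" .
qed

text \<open>A vector of norm \<open>r\<close> in the span has coordinates of norm at most
  \<open>2 * C * r\<close>, so its cost is at most \<open>2 * C * r\<close> times the sum of the
  weights; the lower bound makes this equal to 1. Finiteness excludes a zero ratio of height to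
  radius.\<close>

lemma inner_radius_body:
  assumes E: "initial_span \<beta> k = span (\<Union>i<Suc n. X i)"
  shows "inner_radius \<beta> body k \<ge> ennreal (1 / (2 * C * (\<Sum>i<Suc n. b i)))"
    and "inner_radius \<beta> body k < top"
proof -
  define S where "S = (\<Sum>i<Suc n. b i)"
  define r where "r = 1 / (2 * C * S)"
  have S: "S > 0"
    unfolding S_def using b_pos by (intro sum_pos) auto
  have r: "r > 0"
    using S C_pos by (simp add: r_def)
  have "x \<in> body" if x: "norm x \<le> r" "x \<in> span (\<Union>i<Suc n. X i)" for x
  proof -
    have "cost m x \<le> 1" for m
    proof -
      have "cost m x \<le> cost (m + Suc n) x"
        by (rule cost_mono) simp
      also have "cost (m + Suc n) x = cost (Suc n) x"
        by (induction m) (simp_all add: cost_def fdd_coord_span[OF X x(2)])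
      also have "\<dots> \<le> (\<Sum>i<Suc n. b i * (2 * C * r))"
        unfolding cost_def
      proof (intro sum_mono mult_left_mono)
        fix i
        have "2 * C * norm x \<le> 2 * C * r"
          using x C_pos by simp
        then show "norm (coord i x) \<le> 2 * C * r"
          using coord_le[of i x] by linarith
        show "0 \<le> b i" using b_pos[of i] by simp
      qed
      also have "\<dots> = S * (2 * C * r)"
        by (simp only: S_def sum_distrib_right)
      also have "\<dots> = 1"
        using S C_pos by (simp add: r_def)
      finally show ?thesis .
    qed
    then show ?thesis by (simp add: body_def)
  qed
  then have "r \<in> {r. 0 \<le> r \<and>
      (\<exists>x \<in> initial_span \<beta> k. cball x r \<inter> initial_span \<beta> k \<subseteq> body \<inter> initial_span \<beta> k)}"
    unfolding E using r by (auto intro!: bexI[of _ 0] span_zero)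
  then have "ennreal r \<le> inner_radius \<beta> body k"
    unfolding inner_radius_def by (rule SUP_upper)
  then show "inner_radius \<beta> body k \<ge> ennreal (1 / (2 * C * (\<Sum>i<Suc n. b i)))"
    by (simp only: r_def S_def)
  obtain e where e: "e \<in> X 0" "e \<noteq> 0"
    by (rule body_element_exists)
  \<comment> \<open>In the direction \<open>e\<close> a ball of radius \<open>t\<close> has a point
    at distance exactly \<open>t\<close> from its centre, and both points lie in the unit
    ball.\<close>
  have "inner_radius \<beta> body k \<le> ennreal 2"
    unfolding inner_radius_def E
  proof (intro SUP_least ennreal_leI, safe)
    fix t x assume t: "0 \<le> t" and x: "x \<in> span (\<Union>i<Suc n. X i)"
      and sub: "cball x t \<inter> span (\<Union>i<Suc n. X i) \<subseteq> body \<inter> span (\<Union>i<Suc n. X i)"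
    let ?y = "x + (t / norm e) *\<^sub>R e"
    have "?y \<in> span (\<Union>i<Suc n. X i)"
      using x e by (intro span_add span_scale) (auto intro!: span_base)
    moreover have "?y \<in> cball x t"
      using t e by (simp add: dist_norm)
    ultimately have "norm ?y \<le> 1" "norm x \<le> 1"
      using sub x t by (auto intro!: norm_body_le)
    moreover have "t = norm (?y - x)"
      using t e by simp
    ultimately show "t \<le> 2"
      using norm_triangle_ineq4[of ?y x] by linarith
  qed
  then show "inner_radius \<beta> body k < top"
    using ennreal_less_top le_less_trans by blast
qed

lemma height_inner_radius_ratio:
  assumes E: "initial_span \<beta> k = span (\<Union>i<Suc n. X i)"
    and q: "2 * C * (\<Sum>i<Suc n. b i) \<le> q * b (Suc n)" "q \<ge> 0"
  shows "0 < height \<beta> body k / inner_radius \<beta> body k"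
    and "height \<beta> body k / inner_radius \<beta> body k \<le> ennreal q"
proof -
  define r where "r = 1 / (2 * C * (\<Sum>i<Suc n. b i))"
  have "(\<Sum>i<Suc n. b i) > 0"
    using b_pos by (intro sum_pos) auto
  then have S: "2 * C * (\<Sum>i<Suc n. b i) > 0"
    using C_pos by simp
  then have r: "r > 0" by (simp add: r_def)
  have R: "ennreal r \<le> inner_radius \<beta> body k" "inner_radius \<beta> body k < top"
    using inner_radius_body[OF E] by (simp_all only: r_def)
  show "0 < height \<beta> body k / inner_radius \<beta> body k"
    using height_body(2)[OF E] R by (simp add: ennreal_zero_less_divide)
  have "height \<beta> body k \<le> ennreal (1 / b (Suc n))"
    by (rule height_body(1)[OF E])
  \<comment> \<open>This is the hypothesis on \<open>q\<close>, divided by \<open>b (Suc n)\<close>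
    and the sum of weights with its factor \<open>2 * C\<close>.\<close>
  also have "1 / b (Suc n) \<le> r * q"
    using S q b_pos[of "Suc n"] unfolding r_def by (simp add: field_simps del: sum.lessThan_Suc)
  then have "ennreal (1 / b (Suc n)) \<le> ennreal r * ennreal q"
    using r q by (simp add: ennreal_leI flip: ennreal_mult)
  also have "\<dots> \<le> inner_radius \<beta> body k * ennreal q"
    by (intro mult_right_mono R) auto
  finally show "height \<beta> body k / inner_radius \<beta> body k \<le> ennreal q"
    using R r by (intro divide_le_posI_ennreal) (auto intro: less_le_trans[of 0 "ennreal r"])
qed

end

section \<open>Choice of the weights and conclusion\<close>

text \<open>The recursion is \<open>b (Suc n) = 2 * b n / c n\<close>. From
  \<open>c n \<le> 1\<close> the weights at least double, so the sum up to \<open>n\<close> is at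
  most \<open>2 * b n\<close>; this equals \<open>c n * b (Suc n)\<close>, and
  \<open>c n \<le> q n\<close>.\<close>

lemma fast_growing_weights:
  fixes q :: "nat \<Rightarrow> real"
  assumes q: "\<And>n. q n > 0"
  obtains b :: "nat \<Rightarrow> real"
  where "\<And>n. 2 ^ n \<le> b n" "\<And>n. (\<Sum>i<n. b i) \<le> b n" "\<And>n. (\<Sum>i<Suc n. b i) \<le> q n * b (Suc n)"
proof -
  define c where "c n = min 1 (q n)" for n
  define b where "b n = (\<Prod>i<n. 2 / c i)" for n
  have c: "0 < c n" "c n \<le> 1" "c n \<le> q n" for n
    using q[of n] by (auto simp: c_def)
  have b_Suc: "b (Suc n) = b n * (2 / c n)" for n
    by (simp add: b_def)
  have b_ge: "2 ^ n \<le> b n" for n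
  proof (induction n)
    case (Suc n)
    have "2 ^ n * 2 \<le> b n * (2 / c n)"
      using Suc c[of n] by (intro mult_mono) (auto simp: field_simps intro: order_trans[of _ "2^n"])
    then show ?case by (simp add: b_Suc)
  qed (simp add: b_def)
  have b_pos: "b n > 0" for n
    using b_ge[of n] by (smt (verit) zero_less_power)
  have double: "2 * b n \<le> b (Suc n)" for n
    unfolding b_Suc using c[of n] b_pos[of n] by (simp add: field_simps)
  have sum: "(\<Sum>i<Suc n. b i) \<le> 2 * b n" for n
  proof (induction n)
    case (Suc n)
    then show ?case using double[of n] by simp
  qed (simp add: b_def)
  show thesis
  proof
    show "2 ^ n \<le> b n" for n by (rule b_ge)
    show "(\<Sum>i<n. b i) \<le> b n" for n
    proof (cases n)
      case 0
      then show ?thesis using b_pos[of 0] by simp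
    next
      case (Suc m)
      then show ?thesis using order_trans[OF sum[of m] double[of m]] by simp
    qed
    show "(\<Sum>i<Suc n. b i) \<le> q n * b (Suc n)" for n
    proof -
      have "2 * b n \<le> q n * (b n * (2 / c n))"
        using c[of n] b_pos[of n] by (simp add: field_simps)
      then show ?thesis using sum[of n] by (simp add: b_Suc)
    qed
  qed
qed

theorem proposition4p6:
  assumes "separable_space (euclidean :: 'a::banach topology)"
    and "\<exists>X :: nat \<Rightarrow> 'a set. fdd X"
  shows "\<exists>K :: 'a set. small K \<and> gccr K"
proof -
  obtain X :: "nat \<Rightarrow> 'a set" where X: "fdd X"
    using assms by blast
  obtain C where C: "C > 0" "\<And>n x. norm (fdd_proj X n x) \<le> C * norm x"
    using fdd_proj_uniformly_bounded[OF X] by blast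
  obtain \<beta> :: "nat \<Rightarrow> 'a" and \<tau> :: "nat \<Rightarrow> nat"
    where \<tau>: "strict_mono \<tau>" "\<And>n. initial_span \<beta> (\<tau> n) = span (\<Union>i<n. X i)"
    by (rule fdd_enumeration[OF X]) (rule that)
  \<comment> \<open>The shift skips the trivial subspace, where the inner radius would be infinite,
    and ensures \<open>1 \<le> \<sigma> n\<close>.\<close>
  define \<sigma> where "\<sigma> n = \<tau> (Suc n)" for n
  define \<epsilon> :: real where "\<epsilon> = 1 / 2"
  \<comment> \<open>The bound demanded by \<open>small\<close>. It depends only on the enumeration
    and \<open>\<epsilon>\<close>, so the weights can be adapted to it afterwards.\<close>
  define q where "q n = 1 / (2 * real (\<sigma> n) ^ 2 * ((1 + 2 / \<epsilon>) ^ \<sigma> n + 2))" for n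
  have \<sigma>_mono: "strict_mono \<sigma>"
    using \<tau>(1) by (simp add: \<sigma>_def strict_mono_def)
  have \<sigma>_ge: "1 \<le> \<sigma> n" for n
    using strict_mono_imp_increasing[OF \<tau>(1), of "Suc n"] by (simp add: \<sigma>_def)
  have q_pos: "q n > 0" for n
    unfolding q_def \<epsilon>_def using \<sigma>_ge[of n]
    by (intro divide_pos_pos mult_pos_pos add_pos_pos zero_less_power) auto
  \<comment> \<open>Dividing by \<open>2 * C\<close> absorbs the constant in the lower bound for the
    inner radius.\<close>
  obtain b where b: "\<And>n. 2 ^ n \<le> b n" "\<And>n. (\<Sum>i<n. b i) \<le> b n"
    "\<And>n. (\<Sum>i<Suc n. b i) \<le> q n / (2 * C) * b (Suc n)"
    by (rule fast_growing_weights[of "\<lambda>n. q n / (2 * C)"]) (use q_pos C(1) in auto)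
  interpret weighted_fdd X b C
    using X C b by unfold_locales
  have "fundamental_sequence \<beta>"
    unfolding fundamental_sequence_def
  proof (rule fdd_dense_span[OF X])
    fix i
    have "X i \<subseteq> span (\<Union>j<Suc i. X j)"
      by (auto intro!: span_base)
    also have "\<dots> = initial_span \<beta> (\<tau> (Suc i))"
      by (simp only: \<tau>)
    also have "\<dots> \<subseteq> span (range \<beta>)"
      unfolding initial_span_def by (intro span_mono) auto
    finally show "X i \<subseteq> span (range \<beta>)" .
  qed
  moreover have "0 < height \<beta> body (\<sigma> n) / inner_radius \<beta> body (\<sigma> n) \<and>
      height \<beta> body (\<sigma> n) / inner_radius \<beta> body (\<sigma> n) \<le> ennreal (q n)" for n
  proof -
    have "2 * C * (\<Sum>i<Suc n. b i) \<le> q n * b (Suc n)"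
      using b(3)[of n] C(1) by (simp add: field_simps del: sum.lessThan_Suc)
    from height_inner_radius_ratio[OF _ this] show ?thesis
      using \<tau>(2)[of "Suc n"] q_pos[of n] by (simp add: \<sigma>_def)
  qed
  ultimately have "small body"
    unfolding small_def q_def using bounded_body \<sigma>_mono \<sigma>_ge
    by (intro conjI exI[of _ \<epsilon>] exI[of _ \<beta>] exI[of _ \<sigma>]) (auto simp: \<epsilon>_def)
  then show ?thesis
    using gccr_body by blast
qed

end
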